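(* Let $X(t)$ be the LTD on a network $\mathcal G=(\mathcal V,\mathcal E,W)$ with constant external field $h\in\mathbb R^{\mathcal V}$ and any initial configuration. Then with probability $1$ there exists $t_0\ge0$ such that $X(t)\in\mathcal X^*_h$ for all $t\ge t_0$.
   Context: A network is $\mathcal G=(\mathcal V,\mathcal E,W)$ with finite node set $\mathcal V$, links $\mathcal E\subseteq\mathcal V\times\mathcal V$, weight matrix $W\in\mathbb R_+^{\mathcal V\times\mathcal V}$ with zero diagonal, $W_{ij}>0$ iff $(i,j)\in\mathcal E$. $\mathcal X=\{-1,+1\}^{\mathcal V}$. LTD with constant external field $h$: $X(t)\in\mathcal X$; each agent $i$ has an independent rate-$1$ Poisson clock; when $i$'s clock ticks at time $t$, only $i$ updates, setting $X_i(t)=+1$ if $\sum_jW_{ij}X_j(t^-)+h_i>0$, $X_i(t)=X_i(t^-)$ if $=0$, $X_i(t)=-1$ if $<0$. $\mathcal X^*_h$ is the set of (pure Nash) equilibria of the coordination game on $\mathcal G$ with external field $h$: players $\mathcal V$, actions $\{\pm1\}$, utilities $u_i(x)=x_i(\sum_jW_{ij}x_j+h_i)$; $x^*$ is an equilibrium if for all $i$, $x_i^*$ maximizes $u_i(\cdot,x^*_{-i})$ over $\{\pm1\}$. *)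

theory Defs
  imports "HOL-Probability.Probability"
begin

definition configs :: "('v \<Rightarrow> real) set" where
  "configs = {x. \<forall>i. x i = 1 \<or> x i = -1}"

text \<open>Network: weight matrix with nonnegative entries and zero diagonal
 (links are exactly the pairs with positive weight).\<close>
definition network :: "('v \<Rightarrow> 'v \<Rightarrow> real) \<Rightarrow> bool" where
  "network W \<longleftrightarrow> (\<forall>i j. W i j \<ge> 0) \<and> (\<forall>i. W i i = 0)"

definition utility :: "('v::finite \<Rightarrow> 'v \<Rightarrow> real) \<Rightarrow> ('v \<Rightarrow> real) \<Rightarrow> 'v \<Rightarrow> ('v \<Rightarrow> real) \<Rightarrow> real" where
  "utility W h i x = x i * ((\<Sum>j\<in>UNIV. W i j * x j) + h i)"

definition equilibria :: "('v::finite \<Rightarrow> 'v \<Rightarrow> real) \<Rightarrow> ('v \<Rightarrow> real) \<Rightarrow> ('v \<Rightarrow> real) set" where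
  "equilibria W h = {x \<in> configs. \<forall>i. \<forall>a \<in> {-1, 1::real}.
      utility W h i (x(i := a)) \<le> utility W h i x}"

definition ltd_update :: "('v::finite \<Rightarrow> 'v \<Rightarrow> real) \<Rightarrow> ('v \<Rightarrow> real) \<Rightarrow> 'v \<Rightarrow> ('v \<Rightarrow> real) \<Rightarrow> ('v \<Rightarrow> real)" where
  "ltd_update W h i x =
     (let s = (\<Sum>j\<in>UNIV. W i j * x j) + h i in
      x(i := (if s > 0 then 1 else if s < 0 then -1 else x i)))"

text \<open>Tick times of agent i's Poisson clock built from interarrival times tau:
  the k-th tick (k = 0,1,...) is tau(i,0) + ... + tau(i,k).\<close>
definition tick :: "('v \<times> nat \<Rightarrow> real) \<Rightarrow> 'v \<Rightarrow> nat \<Rightarrow> real" where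
  "tick tau i k = (\<Sum>m\<le>k. tau (i, m))"

definition ltd_state :: "('v::{finite,linorder} \<Rightarrow> 'v \<Rightarrow> real) \<Rightarrow> ('v \<Rightarrow> real) \<Rightarrow>
    ('v \<Rightarrow> real) \<Rightarrow> ('v \<times> nat \<Rightarrow> real) \<Rightarrow> real \<Rightarrow> ('v \<Rightarrow> real)" where
  "ltd_state W h x0 tau t =
     fold (\<lambda>s x. fold (ltd_update W h)
                          (sorted_list_of_set {i. \<exists>k. tick tau i k = s}) x)
          (sorted_list_of_set {s. \<exists>i k. s = tick tau i k \<and> 0 \<le> s \<and> s \<le> t}) x0"

end

(* Since the weights are nonnegative, the game is supermodular: from any configuration, performing
   all profitable upward moves and then all profitable downward moves ends in an equilibrium.
   Equilibria are absorbing, so there is one finite word of agents whose successive updates lead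
   every configuration into an equilibrium; a repeated update of the same agent changes nothing.
   Hence it suffices that almost surely, starting at some integer time, the agents ticking in
   consecutive unit time intervals spell this word. The events "clock i is silent during [j, j + 1)"
   are independent with probability exp (-1): by the definition of independence only void
   probabilities P(no tick in a finite union of unit intervals) are needed, and these come from
   a martingale. So disjoint blocks of time spell the word independently, with probability bounded
   below. *)
theory Submission
  imports Defs
begin

section \<open>Best-response words\<close>

definition field :: "('v::finite \<Rightarrow> 'v \<Rightarrow> real) \<Rightarrow> ('v \<Rightarrow> real) \<Rightarrow> 'v \<Rightarrow> ('v \<Rightarrow> real) \<Rightarrow> real" where
  "field W h i x = (\<Sum>j\<in>UNIV. W i j * x j) + h i"

lemma ltd_update_field:
  "ltd_update W h i x =
     x(i := (if field W h i x > 0 then 1 else if field W h i x < 0 then -1 else x i))"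
  by (simp add: ltd_update_def field_def Let_def)

lemma field_fun_upd_self:
  assumes "network W"
  shows "field W h i (x(i := a)) = field W h i x"
  unfolding field_def using assms by (intro arg_cong2[where f="(+)"] sum.cong) (auto simp: network_def)

lemma field_mono:
  assumes "network W" "\<And>j. x j \<le> y j"
  shows "field W h i x \<le> field W h i y"
  unfolding field_def using assms by (intro add_mono sum_mono mult_left_mono) (auto simp: network_def)

lemma ltd_update_configs: "x \<in> configs \<Longrightarrow> ltd_update W h i x \<in> configs"
  by (auto simp: configs_def ltd_update_field)

lemma fold_ltd_update_configs: "x \<in> configs \<Longrightarrow> fold (ltd_update W h) w x \<in> configs"
  by (induction w arbitrary: x) (auto simp: ltd_update_configs)

text \<open>The first update of \<open>i\<close> does not change the field at \<open>i\<close>,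
  because the diagonal of \<open>W\<close> is zero, so the second makes the same choice. This is why
  several ticks of one agent in a unit interval count as one.\<close>

lemma ltd_update_idem:
  assumes "network W"
  shows "ltd_update W h i (ltd_update W h i x) = ltd_update W h i x"
  using field_fun_upd_self[OF assms] by (auto simp: ltd_update_field)

text \<open>By the zero diagonal the payoff of action \<open>a\<close> is \<open>a\<close> times a
  field independent of \<open>a\<close>. Being a best response is then a sign condition, with both
  actions optimal at field zero.\<close>

lemma equilibria_iff:
  assumes "network W"
  shows "x \<in> equilibria W h \<longleftrightarrow>
    x \<in> configs \<and> (\<forall>i. (x i = -1 \<longrightarrow> field W h i x \<le> 0) \<and> (x i = 1 \<longrightarrow> field W h i x \<ge> 0))"
proof -
  have u: "utility W h i (x(i := a)) = a * field W h i x" for i a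
    using field_fun_upd_self[OF assms, of h i x a] by (simp add: utility_def field_def)
  have u': "utility W h i x = x i * field W h i x" for i
    by (simp add: utility_def field_def)
  show ?thesis
    unfolding equilibria_def mem_Collect_eq u u'
  proof (intro conj_cong refl all_cong1)
    fix i assume "x \<in> configs"
    then have "x i = 1 \<or> x i = -1" by (simp add: configs_def)
    then show "(\<forall>a\<in>{-1, 1}. a * field W h i x \<le> x i * field W h i x) \<longleftrightarrow>
        (x i = -1 \<longrightarrow> field W h i x \<le> 0) \<and> (x i = 1 \<longrightarrow> field W h i x \<ge> 0)"
      by auto
  qed
qed

text \<open>A nonzero field at an equilibrium already has the sign of the action, and at field zero
  the update keeps the action.\<close>

lemma ltd_update_equilibrium:
  assumes "network W" "x \<in> equilibria W h"
  shows "ltd_update W h i x = x"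
proof -
  have "x i = 1 \<or> x i = -1" using assms by (auto simp: equilibria_iff configs_def)
  then show ?thesis
    using assms by (auto simp: equilibria_iff ltd_update_field)
qed

lemma fold_ltd_update_equilibrium:
  assumes "network W" "x \<in> equilibria W h"
  shows "fold (ltd_update W h) w x = x"
  by (induction w) (auto simp: ltd_update_equilibrium[OF assms])

text \<open>Each profitable upward move removes an agent from the finite set playing -1, so such
  moves run out.\<close>

lemma reach_no_upward_incentive:
  assumes "x \<in> configs"
  shows "\<exists>w. \<forall>i. fold (ltd_update W h) w x i = -1 \<longrightarrow> field W h i (fold (ltd_update W h) w x) \<le> 0"
  using assms
proof (induction "card {i. x i = -1}" arbitrary: x rule: less_induct)
  case less
  show ?case
  proof (cases "\<forall>i. x i = -1 \<longrightarrow> field W h i x \<le> 0")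
    case True
    then show ?thesis by (intro exI[of _ "[]"]) simp
  next
    case False
    then obtain i where i: "x i = -1" "field W h i x > 0" by force
    let ?y = "ltd_update W h i x"
    have "{j. ?y j = -1} = {j. x j = -1} - {i}"
      using i by (auto simp: ltd_update_field)
    then have "card {j. ?y j = -1} < card {j. x j = -1}"
      using i by (intro psubset_card_mono) auto
    from less.hyps[OF this ltd_update_configs[OF less.prems]] obtain w
      where "\<forall>j. fold (ltd_update W h) w ?y j = -1 \<longrightarrow> field W h j (fold (ltd_update W h) w ?y) \<le> 0" by blast
    then show ?thesis by (intro exI[of _ "i # w"]) simp
  qed
qed

text \<open>Downward moves only lower the local fields, because the weights are nonnegative;
  so no agent at -1 acquires an incentive to switch up again.\<close>
lemma reach_equilibrium_downwards:
  assumes "network W" "x \<in> configs" "\<And>i. x i = -1 \<Longrightarrow> field W h i x \<le> 0"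
  shows "\<exists>w. fold (ltd_update W h) w x \<in> equilibria W h"
  using assms(2,3)
proof (induction "card {i. x i = 1}" arbitrary: x rule: less_induct)
  case less
  show ?case
  proof (cases "\<forall>i. x i = 1 \<longrightarrow> field W h i x \<ge> 0")
    case True
    then show ?thesis using less.prems
      by (intro exI[of _ "[]"]) (simp add: equilibria_iff[OF assms(1)])
  next
    case False
    then obtain i where i: "x i = 1" "field W h i x < 0" by force
    let ?y = "ltd_update W h i x"
    have y: "?y = x(i := -1)"
      using i by (simp add: ltd_update_field)
    then have "{j. ?y j = 1} = {j. x j = 1} - {i}"
      by auto
    then have "card {j. ?y j = 1} < card {j. x j = 1}"
      using i by (intro psubset_card_mono) auto
    moreover have "field W h j ?y \<le> 0" if "?y j = -1" for j
    proof -
      have "field W h j ?y \<le> field W h j x"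
        using assms(1) i by (intro field_mono) (auto simp: y)
      \<comment> \<open>Either \<open>j\<close> is the agent just lowered, whose field was negative,
        or \<open>j\<close> was at -1 before the move and the hypothesis on \<open>x\<close>
        applies.\<close>
      also have "\<dots> \<le> 0"
        using that less.prems(2)[of j] i by (cases "j = i") (auto simp: y)
      finally show ?thesis .
    qed
    ultimately obtain w where "fold (ltd_update W h) w ?y \<in> equilibria W h"
      using less.hyps[of ?y] ltd_update_configs[OF less.prems(1)] by blast
    then show ?thesis by (intro exI[of _ "i # w"]) simp
  qed
qed

lemma reach_equilibrium:
  assumes "network W" "x \<in> configs"
  shows "\<exists>w. fold (ltd_update W h) w x \<in> equilibria W h"
proof -
  obtain w where w: "\<forall>i. fold (ltd_update W h) w x i = -1 \<longrightarrow> field W h i (fold (ltd_update W h) w x) \<le> 0"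
    using reach_no_upward_incentive[OF assms(2)] by blast
  obtain w' where "fold (ltd_update W h) w' (fold (ltd_update W h) w x) \<in> equilibria W h"
    using reach_equilibrium_downwards[OF assms(1) fold_ltd_update_configs[OF assms(2)]] w by blast
  then show ?thesis by (intro exI[of _ "w @ w'"]) simp
qed

lemma finite_configs: "finite (configs :: ('v::finite \<Rightarrow> real) set)"
proof -
  have "(configs :: ('v \<Rightarrow> real) set) = (\<Pi>\<^sub>E i\<in>UNIV. {1, -1})"
    by (auto simp: configs_def PiE_def)
  moreover have "finite (\<Pi>\<^sub>E i\<in>(UNIV :: 'v set). {1, -1 :: real})"
    by (rule finite_PiE) simp_all
  ultimately show ?thesis by metis
qed

text \<open>Equilibria are fixed by every update, so words steering the configurations one after
  the other into equilibria can be concatenated.\<close>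
lemma universal_word:
  assumes "network W"
  shows "\<exists>w. \<forall>x\<in>configs. fold (ltd_update W h) w x \<in> equilibria W h"
proof -
  have "\<exists>w. \<forall>x\<in>A. fold (ltd_update W h) w x \<in> equilibria W h" if "finite A" "A \<subseteq> configs" for A
    using that
  proof (induction A)
    case (insert a A)
    then obtain w where w: "\<forall>x\<in>A. fold (ltd_update W h) w x \<in> equilibria W h" by auto
    \<comment> \<open>\<open>w'\<close> starts where \<open>w\<close> has taken \<open>a\<close>;
      the configurations in \<open>A\<close> are led into equilibria by \<open>w\<close> and stay
      there.\<close>
    obtain w' where "fold (ltd_update W h) w' (fold (ltd_update W h) w a) \<in> equilibria W h"
      using reach_equilibrium[OF assms fold_ltd_update_configs] insert.prems by blast
    then show ?case
      using w by (intro exI[of _ "w @ w'"]) (auto simp: fold_ltd_update_equilibrium[OF assms])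
  qed simp
  from this[OF finite_configs] show ?thesis by blast
qed

section \<open>Tick sequences\<close>

lemma sorted_list_of_set_Un_less:
  fixes A B :: "'a::linorder set"
  assumes "finite A" "finite B" "\<And>a b. a \<in> A \<Longrightarrow> b \<in> B \<Longrightarrow> a < b"
  shows "sorted_list_of_set (A \<union> B) = sorted_list_of_set A @ sorted_list_of_set B"
  using assms
  by (intro sorted_distinct_set_unique) (auto simp: sorted_append intro: less_imp_le dest: order.strict_implies_not_eq)

text \<open>Inner fold of \<open>ltd_state\<close>: should several clocks tick at the same instant,
  their agents act in the order of \<open>'v\<close>.\<close>

definition tick_step :: "('v::{finite,linorder} \<Rightarrow> 'v \<Rightarrow> real) \<Rightarrow> ('v \<Rightarrow> real) \<Rightarrow>
    ('v \<times> nat \<Rightarrow> real) \<Rightarrow> real \<Rightarrow> ('v \<Rightarrow> real) \<Rightarrow> ('v \<Rightarrow> real)" where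
  "tick_step W h tau s = fold (ltd_update W h) (sorted_list_of_set {i. \<exists>k. tick tau i k = s})"

text \<open>Generalizes the window \<open>{0..t}\<close> of \<open>ltd_state\<close> to any set of
  times, so that time can be cut into pieces.\<close>

definition run :: "('v::{finite,linorder} \<Rightarrow> 'v \<Rightarrow> real) \<Rightarrow> ('v \<Rightarrow> real) \<Rightarrow>
    ('v \<times> nat \<Rightarrow> real) \<Rightarrow> real set \<Rightarrow> ('v \<Rightarrow> real) \<Rightarrow> ('v \<Rightarrow> real)" where
  "run W h tau S = fold (tick_step W h tau) (sorted_list_of_set {s \<in> S. \<exists>i k. s = tick tau i k})"

text \<open>Guards against a default value: \<open>sorted_list_of_set\<close> of an infinite set is
  the empty list, so \<open>run\<close> would skip all ticks of a window containing infinitely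
  many.\<close>

definition nonexplosive :: "('v \<times> nat \<Rightarrow> real) \<Rightarrow> bool" where
  "nonexplosive tau \<longleftrightarrow> (\<forall>t. finite {s. \<exists>i k. s = tick tau i k \<and> s \<le> t})"

lemma ltd_state_run: "ltd_state W h x0 tau t = run W h tau {0..t} x0"
  unfolding ltd_state_def run_def tick_step_def
  by (rule arg_cong[where f="\<lambda>A. fold _ (sorted_list_of_set A) x0"]) auto

text \<open>The bound \<open>t\<close> makes both sets of ticks finite, and the time order makes the
  sorted list of the union a concatenation.\<close>

lemma run_Un:
  assumes "nonexplosive tau" "A \<union> B \<subseteq> {..t}" "\<And>a b. a \<in> A \<Longrightarrow> b \<in> B \<Longrightarrow> a < b"
  shows "run W h tau (A \<union> B) x = run W h tau B (run W h tau A x)"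
proof -
  let ?T = "\<lambda>S. {s \<in> S. \<exists>i k. s = tick tau i k}"
  have "finite (?T (A \<union> B))"
    by (rule finite_subset[of _ "{s. \<exists>i k. s = tick tau i k \<and> s \<le> t}"])
       (use assms in \<open>auto simp: nonexplosive_def\<close>)
  moreover have U: "?T (A \<union> B) = ?T A \<union> ?T B" by auto
  ultimately have "finite (?T A)" "finite (?T B)" by simp_all
  from sorted_list_of_set_Un_less[OF this] assms(3) show ?thesis
    unfolding run_def U by simp
qed

lemma run_configs: "x \<in> configs \<Longrightarrow> run W h tau S x \<in> configs"
proof -
  have "x \<in> configs \<Longrightarrow> fold (tick_step W h tau) l x \<in> configs" for l
    by (induction l arbitrary: x) (auto simp: tick_step_def fold_ltd_update_configs)
  then show "x \<in> configs \<Longrightarrow> run W h tau S x \<in> configs" by (simp add: run_def)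
qed

lemma run_equilibrium:
  assumes "network W" "x \<in> equilibria W h"
  shows "run W h tau S x = x"
proof -
  have "fold (tick_step W h tau) l x = x" for l
    by (induction l) (auto simp: tick_step_def fold_ltd_update_equilibrium[OF assms])
  then show ?thesis by (simp add: run_def)
qed

text \<open>Every tick in \<open>S\<close> is an update of \<open>i\<close>, at least one occurs,
  and repetitions are absorbed by idempotence.\<close>

lemma run_single_agent:
  assumes "network W" "nonexplosive tau" "S \<subseteq> {..t}"
    and ex: "\<exists>k. tick tau i k \<in> S" and only: "\<And>j k. tick tau j k \<in> S \<Longrightarrow> j = i"
  shows "run W h tau S x = ltd_update W h i x"
proof -
  let ?T = "{s \<in> S. \<exists>i k. s = tick tau i k}"
  have fin: "finite ?T"
    by (rule finite_subset[of _ "{s. \<exists>i k. s = tick tau i k \<and> s \<le> t}"])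
       (use assms in \<open>auto simp: nonexplosive_def\<close>)
  have step: "tick_step W h tau s = ltd_update W h i" if "s \<in> ?T" for s
  proof -
    have "{j. \<exists>k. tick tau j k = s} = {i}" using that only by blast
    then show ?thesis by (simp add: tick_step_def)
  qed
  have *: "fold (tick_step W h tau) l y = (if l = [] then y else ltd_update W h i y)"
    if "set l \<subseteq> ?T" for l y
    using that
    by (induction l arbitrary: y) (simp_all add: step ltd_update_idem[OF assms(1)])
  have "?T \<noteq> {}" using ex by blast
  with *[of "sorted_list_of_set ?T" x] fin show ?thesis
    unfolding run_def by (simp only: set_sorted_list_of_set sorted_list_of_set_eq_Nil_iff order_refl if_False)
qed

text \<open>The floor condition places a tick in \<open>[a + j, a + j + 1)\<close>. Induction splits
  off the last unit interval, where only the agent named by the last letter ticks.\<close>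

lemma run_word:
  assumes "network W" "nonexplosive tau"
    and "\<And>j i. j < length w \<Longrightarrow> (\<exists>k. \<lfloor>tick tau i k\<rfloor> = int (a + j)) \<longleftrightarrow> w ! j = i"
  shows "run W h tau {real a..<real (a + length w)} x = fold (ltd_update W h) w x"
  using assms(3)
proof (induction w rule: rev_induct)
  case Nil
  then show ?case by (simp add: run_def)
next
  case (snoc i w)
  let ?n = "length w"
  have fl: "r \<in> {real (a + ?n)..<real (a + Suc ?n)} \<longleftrightarrow> \<lfloor>r\<rfloor> = int (a + ?n)" for r
    by (auto simp: floor_eq_iff)
  have last: "(\<exists>k. \<lfloor>tick tau j k\<rfloor> = int (a + ?n)) \<longleftrightarrow> i = j" for j
    using snoc.prems[of ?n j] by simp
  have "{real a..<real (a + length (w @ [i]))} =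
      {real a..<real (a + ?n)} \<union> {real (a + ?n)..<real (a + Suc ?n)}"
    by (simp add: ivl_disj_un_two)
  then have "run W h tau {real a..<real (a + length (w @ [i]))} x =
      run W h tau {real (a + ?n)..<real (a + Suc ?n)} (run W h tau {real a..<real (a + ?n)} x)"
    by (simp only:) (rule run_Un[OF assms(2), of _ _ "real (a + Suc ?n)"], auto)
  also have "run W h tau {real a..<real (a + ?n)} x = fold (ltd_update W h) w x"
  proof (rule snoc.IH)
    show "(\<exists>k. \<lfloor>tick tau l k\<rfloor> = int (a + j)) \<longleftrightarrow> w ! j = l" if "j < ?n" for j l
      using snoc.prems[of j l] that by (simp add: nth_append)
  qed
  also have "run W h tau {real (a + ?n)..<real (a + Suc ?n)} (fold (ltd_update W h) w x) =
      ltd_update W h i (fold (ltd_update W h) w x)"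
  proof (rule run_single_agent[OF assms(1,2)])
    show "{real (a + ?n)..<real (a + Suc ?n)} \<subseteq> {..real (a + Suc ?n)}" by auto
    show "\<exists>k. tick tau i k \<in> {real (a + ?n)..<real (a + Suc ?n)}"
      using last[of i] fl by blast
    show "j = i" if "tick tau j k \<in> {real (a + ?n)..<real (a + Suc ?n)}" for j k
      using last[of j] that fl by blast
  qed
  finally show ?case by simp
qed

text \<open>Time up to \<open>t\<close> is cut into three pieces: before \<open>a\<close> some
  configuration is reached, the word steers it into an equilibrium whatever it is, and the remaining
  ticks change nothing.\<close>

lemma ltd_state_equilibrium:
  assumes W: "network W" and x0: "x0 \<in> configs" and tau: "nonexplosive tau"
    and univ: "\<And>x. x \<in> configs \<Longrightarrow> fold (ltd_update W h) w x \<in> equilibria W h"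
    and word: "\<And>j i. j < length w \<Longrightarrow> (\<exists>k. \<lfloor>tick tau i k\<rfloor> = int (a + j)) \<longleftrightarrow> w ! j = i"
    and t: "t \<ge> real (a + length w)"
  shows "ltd_state W h x0 tau t \<in> equilibria W h"
proof -
  let ?b = "real (a + length w)"
  have "{0..t} = {0..<real a} \<union> ({real a..<?b} \<union> {?b..t})"
    using t by auto
  then have "ltd_state W h x0 tau t = run W h tau ({real a..<?b} \<union> {?b..t}) (run W h tau {0..<real a} x0)"
    unfolding ltd_state_run
    by (simp only:) (rule run_Un[OF tau, of _ _ t], use t in auto)
  also have "\<dots> = run W h tau {?b..t} (run W h tau {real a..<?b} (run W h tau {0..<real a} x0))"
    by (rule run_Un[OF tau, of _ _ t]) (use t in auto)
  also have "run W h tau {real a..<?b} (run W h tau {0..<real a} x0) =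
      fold (ltd_update W h) w (run W h tau {0..<real a} x0)"
    by (rule run_word[OF W tau word])
  finally show ?thesis
    using univ[OF run_configs[OF x0]] by (simp add: run_equilibrium[OF W])
qed

section \<open>Void probabilities of a renewal process\<close>

text \<open>The exponent is the Lebesgue measure of the part above s of the union of the
  intervals [j, j + 1) with j in J, so this is the probability that a unit-rate Poisson process
  has no point in that part.\<close>
definition void_weight :: "int set \<Rightarrow> real \<Rightarrow> real" where
  "void_weight J s = exp (- (\<Sum>j\<in>J. min 1 (max 0 (of_int j + 1 - s))))"

lemma void_weight_pos: "void_weight J s > 0"
  by (simp add: void_weight_def)

lemma void_weight_le_1: "void_weight J s \<le> 1"
  by (auto simp: void_weight_def intro!: sum_nonneg)

lemma borel_measurable_void_weight [measurable]: "void_weight J \<in> borel_measurable borel"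
  unfolding void_weight_def by measurable

lemma void_weight_0:
  assumes "J \<subseteq> {0..}"
  shows "void_weight J 0 = exp (- real (card J))"
proof -
  have "(\<Sum>j\<in>J. min 1 (max 0 (of_int j + 1 - 0 :: real))) = (\<Sum>j\<in>J. 1)"
    using assms by (intro sum.cong) (auto simp: subset_eq)
  then show ?thesis by (simp add: void_weight_def)
qed

text \<open>As a function of \<open>s + u\<close> the clamped length is 1 before the interval, falls
  with slope -1 inside it and is 0 afterwards; the assumptions exclude the two kinks.\<close>

lemma DERIV_clamp:
  fixes s u :: real and j :: int
  assumes "s + u \<noteq> of_int j" "s + u \<noteq> of_int j + 1"
  shows "((\<lambda>u. min 1 (max 0 (of_int j + 1 - (s + u)))) has_real_derivative
      (if \<lfloor>s + u\<rfloor> = j then -1 else 0)) (at u)"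
proof -
  consider "s + u < of_int j" | "of_int j < s + u \<and> s + u < of_int j + 1" | "of_int j + 1 < s + u"
    using assms by linarith
  then show ?thesis
  proof cases
    case 1
    have "((\<lambda>u. 1 :: real) has_real_derivative (if \<lfloor>s + u\<rfloor> = j then -1 else 0)) (at u)"
      using 1 by (auto simp: floor_eq_iff)
    then show ?thesis
      by (rule has_field_derivative_transform_within_open[where S="{..<of_int j - s}"]) (use 1 in auto)
  next
    case 2
    have "((\<lambda>u. of_int j + 1 - (s + u)) has_real_derivative (if \<lfloor>s + u\<rfloor> = j then -1 else 0)) (at u)"
      using 2 by (auto simp: floor_eq_iff intro!: derivative_eq_intros)
    then show ?thesis
      by (rule has_field_derivative_transform_within_open[where S="{of_int j - s<..<of_int j + 1 - s}"])
         (use 2 in auto)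
  next
    case 3
    have "((\<lambda>u. 0 :: real) has_real_derivative (if \<lfloor>s + u\<rfloor> = j then -1 else 0)) (at u)"
      using 3 by (auto simp: floor_eq_iff)
    then show ?thesis
      by (rule has_field_derivative_transform_within_open[where S="{of_int j + 1 - s<..}"]) (use 3 in auto)
  qed
qed

text \<open>Up to sign, exp (-u) times the weight at s + u is an antiderivative of the integrand:
  on the forbidden set its two factors have opposite logarithmic derivatives. This makes
  the weight, killed on the forbidden set, a martingale along the renewal process.\<close>
lemma nn_integral_exponential_void_weight:
  assumes J: "finite J"
  shows "(\<integral>\<^sup>+u. ennreal (exponential_density 1 u) *
      (if \<lfloor>s + u\<rfloor> \<in> J then 0 else ennreal (void_weight J (s + u))) \<partial>lborel) = void_weight J s"
proof -
  define F where "F u = - exp (-u) * void_weight J (s + u)" for u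
  define g where "g u = (if \<lfloor>s + u\<rfloor> \<in> J then 0 else exp (-u) * void_weight J (s + u))" for u
  \<comment> \<open>The kinks of the exponent. \<open>F\<close> is continuous and differentiable off
    this finite set, which suffices for the fundamental theorem.\<close>
  define S where "S = (\<lambda>j. of_int j - s) ` J \<union> (\<lambda>j. of_int j + 1 - s) ` J"
  have [measurable]: "g \<in> borel_measurable borel"
    unfolding g_def by measurable
  have g0: "g u \<ge> 0" for u
    using void_weight_pos[of J "s + u"] by (simp add: g_def)
  have deriv: "(F has_vector_derivative g u) (at u)" if "u \<notin> S" for u
  proof -
    define C where "C u = (\<Sum>j\<in>J. min 1 (max 0 (of_int j + 1 - (s + u))))" for u
    have "(C has_real_derivative (\<Sum>j\<in>J. if \<lfloor>s + u\<rfloor> = j then -1 else 0)) (at u)"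
      unfolding C_def using that by (intro DERIV_sum DERIV_clamp) (auto simp: S_def image_iff algebra_simps)
    also have "(\<Sum>j\<in>J. if \<lfloor>s + u\<rfloor> = j then -1 else 0) = (if \<lfloor>s + u\<rfloor> \<in> J then -1 else 0 :: real)"
      using J by (simp add: sum.delta')
    finally have D: "(C has_real_derivative (if \<lfloor>s + u\<rfloor> \<in> J then -1 else 0)) (at u)" .
    have w: "void_weight J (s + u) = exp (- C u)"
      by (simp add: void_weight_def C_def)
    from D have "((\<lambda>u. - exp (-u) * exp (- C u)) has_real_derivative g u) (at u)"
      by (auto intro!: derivative_eq_intros simp: g_def w)
    then have "(F has_real_derivative g u) (at u)"
      by (simp add: F_def[abs_def] void_weight_def C_def)
    then show ?thesis by (simp add: has_real_derivative_iff_has_vector_derivative)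
  qed
  have cont: "continuous_on A F" for A
    unfolding F_def void_weight_def by (intro continuous_intros)
  have int: "(g has_integral (F b - F 0)) {0..b}" if "b \<ge> 0" for b
    using that deriv J by (intro fundamental_theorem_of_calculus_strong[of S] cont) (auto simp: S_def)
  have "(g has_integral (void_weight J s)) {0..}"
  proof (rule has_integral_to_inf)
    show "g integrable_on {0..y}" for y
      using int[of y] by (cases "y \<ge> 0") (auto simp: integrable_on_def)
    have "((\<lambda>y. F y) \<longlongrightarrow> 0) at_top"
    proof (rule Lim_null_comparison)
      show "\<forall>\<^sub>F y in at_top. norm (F y) \<le> exp (- y)"
        using void_weight_le_1 void_weight_pos
        by (intro always_eventually allI) (simp add: F_def abs_mult less_imp_le)
      show "((\<lambda>y::real. exp (- y)) \<longlongrightarrow> 0) at_top"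
        by (intro filterlim_compose[OF exp_at_bot] filterlim_uminus_at_bot_at_top)
    qed
    \<comment> \<open>\<open>F 0\<close> is \<open>- void_weight J s\<close>, so the increment of
      \<open>F\<close> from 0 to infinity is the claimed integral.\<close>
    then have "((\<lambda>y. F y - F 0) \<longlongrightarrow> void_weight J s) at_top"
      by (intro tendsto_eq_intros) (auto simp: F_def)
    then show "((\<lambda>y. integral {0..y} g) \<longlongrightarrow> void_weight J s) at_top"
    proof (rule Lim_transform_eventually)
      show "\<forall>\<^sub>F y in at_top. F y - F 0 = integral {0..y} g"
        using eventually_ge_at_top[of 0] by eventually_elim (simp add: integral_unique[OF int])
    qed
  qed (use g0 in auto)
  then have "((\<lambda>u. if u \<in> {0..} then g u else 0) has_integral (void_weight J s)) UNIV"
    by (simp only: has_integral_restrict_UNIV)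
  then have "(\<integral>\<^sup>+u. ennreal (if u \<in> {0..} then g u else 0) \<partial>lborel) = void_weight J s"
    by (intro nn_integral_has_integral_lborel) (auto simp: g0)
  moreover have "ennreal (exponential_density 1 u) * (if \<lfloor>s + u\<rfloor> \<in> J then 0 else ennreal (void_weight J (s + u)))
      = ennreal (if u \<in> {0..} then g u else 0)" for u
    by (auto simp: g_def exponential_density_def ennreal_mult'' void_weight_pos less_imp_le)
  ultimately show ?thesis by simp
qed

text \<open>Independence makes the joint law a product measure, so Tonelli's theorem lets the second
  variable be integrated out first, over an independent copy \<omega>' of the sample point.\<close>

lemma (in prob_space) nn_integral_indep_var:
  assumes "indep_var S Y T X" and [measurable]: "G \<in> borel_measurable (S \<Otimes>\<^sub>M T)"
  shows "(\<integral>\<^sup>+\<omega>. G (Y \<omega>, X \<omega>) \<partial>M) = (\<integral>\<^sup>+\<omega>. (\<integral>\<^sup>+\<omega>'. G (Y \<omega>, X \<omega>') \<partial>M) \<partial>M)"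
proof -
  have rv [measurable]: "random_variable S Y" "random_variable T X"
    and eq: "distr M S Y \<Otimes>\<^sub>M distr M T X = distr M (S \<Otimes>\<^sub>M T) (\<lambda>x. (Y x, X x))"
    using assms(1) unfolding indep_var_distribution_eq by auto
  interpret X: prob_space "distr M T X" by (rule prob_space_distr) fact
  have [measurable_cong]: "sets (distr M S Y \<Otimes>\<^sub>M distr M T X) = sets (S \<Otimes>\<^sub>M T)"
    by (intro sets_pair_measure_cong) simp_all
  have "(\<integral>\<^sup>+\<omega>. G (Y \<omega>, X \<omega>) \<partial>M) = (\<integral>\<^sup>+z. G z \<partial>(distr M S Y \<Otimes>\<^sub>M distr M T X))"
    unfolding eq by (subst nn_integral_distr) simp_all
  also have "\<dots> = (\<integral>\<^sup>+y. (\<integral>\<^sup>+u. G (y, u) \<partial>distr M T X) \<partial>distr M S Y)"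
    by (subst X.nn_integral_fst[symmetric]) (auto intro: assms(2))
  also have "\<dots> = (\<integral>\<^sup>+\<omega>. (\<integral>\<^sup>+u. G (Y \<omega>, u) \<partial>distr M T X) \<partial>M)"
    by (subst nn_integral_distr) (auto intro!: X.borel_measurable_nn_integral)
  also have "\<dots> = (\<integral>\<^sup>+\<omega>. (\<integral>\<^sup>+\<omega>'. G (Y \<omega>, X \<omega>') \<partial>M) \<partial>M)"
    by (intro nn_integral_cong nn_integral_distr measurable_Pair2[OF assms(2)] rv)
       (auto dest: measurable_space[OF rv(1)])
  finally show ?thesis .
qed

section \<open>The unit-rate Poisson process in terms of its gaps\<close>

locale renewal_process = prob_space +
  fixes X :: "nat \<Rightarrow> 'a \<Rightarrow> real"
  assumes indep: "indep_vars (\<lambda>_. borel) X UNIV"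
    and exponential: "\<And>n. distributed M lborel (X n) (\<lambda>x. ennreal (exponential_density 1 x))"
begin

lemma measurable_X [measurable]: "X n \<in> borel_measurable M"
  using distributed_measurable[OF exponential] by simp

text \<open>Martingale property: given the first \<open>n\<close> gaps, integrating over the next
  exponential gap returns the killed weight to its present value, so its expectation never
  changes.\<close>

lemma nn_integral_void_weight:
  assumes J: "finite J"
  shows "(\<integral>\<^sup>+\<omega>. (if \<forall>k<n. \<lfloor>\<Sum>m\<le>k. X m \<omega>\<rfloor> \<notin> J then ennreal (void_weight J (\<Sum>m<n. X m \<omega>)) else 0) \<partial>M)
    = void_weight J 0"
proof (induction n)
  case 0
  then show ?case by (simp add: emeasure_space_1)
next
  case (Suc n)
  \<comment> \<open>The past is the tuple of the first \<open>n\<close> gaps, the future is gap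
    number \<open>n\<close>; \<open>alive\<close> says that none of the first \<open>n\<close>
    arrivals hit a forbidden interval.\<close>
  define S where "S = Pi\<^sub>M {..<n} (\<lambda>_. borel :: real measure)"
  define T where "T = Pi\<^sub>M {n} (\<lambda>_. borel :: real measure)"
  define total :: "(nat \<Rightarrow> real) \<Rightarrow> real" where "total x = (\<Sum>m<n. x m)" for x
  define alive where "alive x \<longleftrightarrow> (\<forall>k\<in>{..<n}. \<lfloor>\<Sum>m\<le>k. x m :: real\<rfloor> \<notin> J)" for x
  define G where "G z = (if alive (fst z) \<and> \<lfloor>total (fst z) + snd z n\<rfloor> \<notin> J
      then ennreal (void_weight J (total (fst z) + snd z n)) else 0)" for z
  have [measurable]: "total \<in> borel_measurable S"
    unfolding S_def total_def by (intro borel_measurable_sum measurable_component_singleton) auto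
  have [measurable]: "Measurable.pred S alive"
    unfolding alive_def
  proof (intro pred_intros_finite)
    fix k assume "k \<in> {..<n}"
    then have [measurable]: "(\<lambda>x. \<Sum>m\<le>k. x m) \<in> borel_measurable S"
      unfolding S_def by (intro borel_measurable_sum measurable_component_singleton) auto
    show "Measurable.pred S (\<lambda>x. \<lfloor>\<Sum>m\<le>k. x m :: real\<rfloor> \<notin> J)"
      by measurable
  qed simp
  have [measurable]: "(\<lambda>z. snd z n) \<in> borel_measurable (S \<Otimes>\<^sub>M T)"
    unfolding T_def by (rule measurable_compose[OF measurable_snd measurable_component_singleton]) simp
  have [measurable]: "G \<in> borel_measurable (S \<Otimes>\<^sub>M T)"
    unfolding G_def by measurable
  let ?Y = "\<lambda>\<omega>. restrict (\<lambda>m. X m \<omega>) {..<n}" and ?Z = "\<lambda>\<omega>. restrict (\<lambda>m. X m \<omega>) {n}"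
  have ind: "indep_var S ?Y T ?Z"
    unfolding S_def T_def by (rule indep_var_restrict[OF indep]) auto
  have total: "total (?Y \<omega>) = (\<Sum>m<n. X m \<omega>)" for \<omega>
    by (simp add: total_def)
  have alive: "alive (?Y \<omega>) \<longleftrightarrow> (\<forall>k<n. \<lfloor>\<Sum>m\<le>k. X m \<omega>\<rfloor> \<notin> J)" for \<omega>
  proof -
    have "(\<Sum>m\<le>k. ?Y \<omega> m) = (\<Sum>m\<le>k. X m \<omega>)" if "k < n" for k
      using that by (intro sum.cong) auto
    then show ?thesis by (simp add: alive_def Ball_def)
  qed
  have inner: "(\<integral>\<^sup>+\<omega>'. G (x, ?Z \<omega>') \<partial>M) = (if alive x then ennreal (void_weight J (total x)) else 0)" for x
  proof -
    have "(\<integral>\<^sup>+\<omega>'. (if \<lfloor>total x + X n \<omega>'\<rfloor> \<in> J then 0 else ennreal (void_weight J (total x + X n \<omega>'))) \<partial>M)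
        = ennreal (void_weight J (total x))"
      by (rule trans[OF distributed_nn_integral[OF exponential, symmetric]
            nn_integral_exponential_void_weight[OF J]]) measurable
    moreover have "G (x, ?Z \<omega>') = (if alive x then if \<lfloor>total x + X n \<omega>'\<rfloor> \<in> J then 0
        else ennreal (void_weight J (total x + X n \<omega>')) else 0)" for \<omega>'
      by (simp add: G_def)
    ultimately show ?thesis by simp
  qed
  have "(\<integral>\<^sup>+\<omega>. (if \<forall>k<Suc n. \<lfloor>\<Sum>m\<le>k. X m \<omega>\<rfloor> \<notin> J then ennreal (void_weight J (\<Sum>m<Suc n. X m \<omega>)) else 0) \<partial>M)
      = (\<integral>\<^sup>+\<omega>. G (?Y \<omega>, ?Z \<omega>) \<partial>M)"
  proof (rule nn_integral_cong)
    fix \<omega>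
    have "(\<Sum>m\<le>n. X m \<omega>) = (\<Sum>m<n. X m \<omega>) + X n \<omega>"
      by (simp add: lessThan_Suc_atMost[symmetric])
    then show "(if \<forall>k<Suc n. \<lfloor>\<Sum>m\<le>k. X m \<omega>\<rfloor> \<notin> J then ennreal (void_weight J (\<Sum>m<Suc n. X m \<omega>)) else 0)
        = G (?Y \<omega>, ?Z \<omega>)"
      unfolding G_def fst_conv snd_conv total alive by (auto simp: less_Suc_eq)
  qed
  also have "\<dots> = (\<integral>\<^sup>+\<omega>. (\<integral>\<^sup>+\<omega>'. G (?Y \<omega>, ?Z \<omega>') \<partial>M) \<partial>M)"
    by (rule nn_integral_indep_var[OF ind]) measurable
  also have "\<dots> = void_weight J 0"
    unfolding inner total alive by (rule Suc.IH)
  finally show ?case .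
qed

text \<open>The Laplace transform of the unit exponential law at 1; any value below 1 would give the
  geometric decay needed for the divergence of the arrival times.\<close>

lemma nn_integral_exp_minus: "(\<integral>\<^sup>+\<omega>. ennreal (exp (- X n \<omega>)) \<partial>M) = ennreal (1 / 2)"
proof -
  have "((\<lambda>u::real. exp (- 2 * u)) has_integral exp (- 2 * 0) / 2) {0..}"
    by (rule has_integral_exp_minus_to_infinity) simp
  then have "((\<lambda>u::real. if u \<in> {0..} then exp (- 2 * u) else 0) has_integral 1 / 2) UNIV"
    by (simp only: has_integral_restrict_UNIV) simp
  then have "(\<integral>\<^sup>+u. ennreal (if u \<in> {0..} then exp (- 2 * u) else 0) \<partial>lborel) = ennreal (1 / 2)"
    by (intro nn_integral_has_integral_lborel) auto
  moreover have "ennreal (exponential_density 1 u) * ennreal (exp (- u)) =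
      ennreal (if u \<in> {0..} then exp (- 2 * u) else 0)" for u
    by (auto simp: exponential_density_def ennreal_mult[symmetric] exp_add[symmetric])
  ultimately show ?thesis
    by (subst distributed_nn_integral[OF exponential, symmetric]) auto
qed

text \<open>The variables \<open>exp (- (\<Sum>m<n. X m \<omega>))\<close> have expectations
  \<open>(1 / 2) ^ n\<close>, which are summable. Hence their series is almost surely finite, its
  terms tend to 0, and the partial sums of the gaps diverge.\<close>

lemma AE_sum_at_top: "AE \<omega> in M. filterlim (\<lambda>n. \<Sum>m<n. X m \<omega>) at_top sequentially"
proof -
  have e: "(\<integral>\<^sup>+\<omega>. ennreal (exp (- (\<Sum>m<n. X m \<omega>))) \<partial>M) = ennreal ((1 / 2) ^ n)" for n
  proof -
    have "indep_vars (\<lambda>_. borel) (\<lambda>m \<omega>. ennreal (exp (- X m \<omega>))) UNIV"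
      by (rule indep_vars_compose2[OF indep]) measurable
    then have "indep_vars (\<lambda>_. borel) (\<lambda>m \<omega>. ennreal (exp (- X m \<omega>))) {..<n}"
      by (rule indep_vars_subset) simp
    from indep_vars_nn_integral[OF _ this]
    have "(\<integral>\<^sup>+\<omega>. (\<Prod>m<n. ennreal (exp (- X m \<omega>))) \<partial>M) = ennreal ((1 / 2) ^ n)"
      by (simp add: nn_integral_exp_minus ennreal_power[symmetric] del: ennreal_divide_numeral)
    then show ?thesis
      by (simp add: sum_negf[symmetric] exp_sum prod_ennreal)
  qed
  have "(\<integral>\<^sup>+\<omega>. (\<Sum>n. ennreal (exp (- (\<Sum>m<n. X m \<omega>)))) \<partial>M) = (\<Sum>n. ennreal ((1 / 2) ^ n))"
    by (subst nn_integral_suminf) (simp_all add: e)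
  also have "\<dots> \<noteq> \<infinity>"
    by (subst suminf_ennreal2) (auto intro!: summable_geometric)
  finally have "AE \<omega> in M. (\<Sum>n. ennreal (exp (- (\<Sum>m<n. X m \<omega>)))) \<noteq> \<infinity>"
    by (intro nn_integral_PInf_AE) auto
  then show ?thesis
  proof eventually_elim
    case (elim \<omega>)
    then have "(\<lambda>n. exp (- (\<Sum>m<n. X m \<omega>))) \<longlonglongrightarrow> 0"
      by (intro summable_LIMSEQ_zero summable_suminf_not_top) auto
    then have "\<forall>\<^sub>F n in sequentially. exp (- (\<Sum>m<n. X m \<omega>)) < exp (- z)" for z
      by (rule order_tendstoD) simp
    from eventually_mono[OF this] have "\<forall>\<^sub>F n in sequentially. z \<le> (\<Sum>m<n. X m \<omega>)" for z
      by (metis exp_less_cancel_iff neg_less_iff_less less_imp_le)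
    then show ?case
      by (simp add: filterlim_at_top)
  qed
qed

text \<open>The killed weight \<Phi> has constant expectation, is bounded by 1 and converges almost
  surely to the indicator of the void event; dominated convergence identifies the limit.\<close>

lemma prob_void:
  assumes J: "finite J" "J \<subseteq> {0..}"
  shows "prob {\<omega> \<in> space M. \<forall>k. \<lfloor>\<Sum>m\<le>k. X m \<omega>\<rfloor> \<notin> J} = exp (- real (card J))"
proof -
  define \<Phi> where "\<Phi> n \<omega> = (if \<forall>k<n. \<lfloor>\<Sum>m\<le>k. X m \<omega>\<rfloor> \<notin> J then void_weight J (\<Sum>m<n. X m \<omega>) else 0)" for n \<omega>
  let ?E = "{\<omega> \<in> space M. \<forall>k. \<lfloor>\<Sum>m\<le>k. X m \<omega>\<rfloor> \<notin> J}"
  have [measurable]: "\<Phi> n \<in> borel_measurable M" for n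
    unfolding \<Phi>_def by measurable
  have E [measurable]: "?E \<in> sets M" by measurable
  have \<Phi>0: "\<Phi> n \<omega> \<ge> 0" for n \<omega>
    using void_weight_pos[of J] by (simp add: \<Phi>_def less_imp_le)
  have "expectation (\<Phi> n) = exp (- real (card J))" for n
  proof -
    have "(\<integral>\<^sup>+\<omega>. ennreal (\<Phi> n \<omega>) \<partial>M) = ennreal (exp (- real (card J)))"
      using nn_integral_void_weight[OF J(1), of n]
      by (simp add: \<Phi>_def void_weight_0[OF J(2)] if_distrib cong: if_cong)
    then show ?thesis
      by (subst integral_eq_nn_integral) (auto simp: \<Phi>0)
  qed
  moreover have "(\<lambda>n. expectation (\<Phi> n)) \<longlonglongrightarrow> expectation (indicator ?E :: 'a \<Rightarrow> real)"
  proof (rule integral_dominated_convergence[where w="\<lambda>_. 1"])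
    show "AE \<omega> in M. (\<lambda>n. \<Phi> n \<omega>) \<longlonglongrightarrow> indicator ?E \<omega>"
      using AE_sum_at_top AE_space
    proof eventually_elim
      case (elim \<omega>)
      show ?case
      proof (cases "\<forall>k. \<lfloor>\<Sum>m\<le>k. X m \<omega>\<rfloor> \<notin> J")
        case True
        \<comment> \<open>Almost surely the arrivals pass all of the finitely many intervals, and
          from then on the weight is 1.\<close>
        have "\<forall>\<^sub>F n in sequentially. \<forall>j\<in>J. of_int j + 1 \<le> (\<Sum>m<n. X m \<omega>)"
          using elim(1) J(1) by (intro eventually_ball_finite) (auto simp: filterlim_at_top)
        then have "\<forall>\<^sub>F n in sequentially. \<Phi> n \<omega> = 1"
          by eventually_elim (use True in \<open>auto simp: \<Phi>_def void_weight_def\<close>)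
        then show ?thesis
          using True elim(2) by (intro tendsto_eventually) (simp add: indicator_def)
      next
        case False
        then obtain k where k: "\<lfloor>\<Sum>m\<le>k. X m \<omega>\<rfloor> \<in> J" by blast
        have "\<forall>\<^sub>F n in sequentially. \<Phi> n \<omega> = 0"
          using eventually_gt_at_top[of k] by eventually_elim (use k in \<open>auto simp: \<Phi>_def\<close>)
        then show ?thesis
          by (intro tendsto_eventually) (use False in \<open>auto simp: indicator_def\<close>)
      qed
    qed
    show "AE \<omega> in M. norm (\<Phi> n \<omega>) \<le> 1" for n
      using void_weight_le_1[of J] void_weight_pos[of J] by (auto simp: \<Phi>_def less_imp_le)
  qed auto
  ultimately have "expectation (indicator ?E :: 'a \<Rightarrow> real) = exp (- real (card J))"
    by (simp add: LIMSEQ_const_iff)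
  then show ?thesis by (simp add: E)
qed

end

text \<open>A weak form of the second Borel-Cantelli lemma: the complements are independent too, so
  the first \<open>n + 1\<close> events all fail with probability at most
  \<open>(1 - c) ^ Suc n\<close>.\<close>

lemma (in prob_space) AE_Ex_indep_events:
  fixes A :: "nat \<Rightarrow> 'a set"
  assumes A: "indep_events A UNIV" and c: "c > 0" "\<And>n. prob (A n) \<ge> c"
  shows "AE \<omega> in M. \<exists>n. \<omega> \<in> A n"
proof -
  have [measurable]: "A n \<in> events" for n
    using A by (auto simp: indep_events_def)
  have "indep_sets (\<lambda>n. {A n}) UNIV"
    using A by (simp add: indep_events_def_alt)
  then have ind: "indep_sets (\<lambda>n. sigma_sets (space M) {A n}) UNIV"
    by (rule indep_sets_sigma) (simp add: Int_stable_def)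
  let ?N = "{\<omega> \<in> space M. \<forall>n. \<omega> \<notin> A n}"
  have "prob ?N \<le> (1 - c) ^ Suc n" for n
  proof -
    have "prob ?N \<le> prob (\<Inter>i\<in>{..n}. space M - A i)"
      by (intro finite_measure_mono) auto
    also have "\<dots> = (\<Prod>i\<le>n. prob (space M - A i))"
      by (rule indep_setsD[OF ind]) (auto intro: sigma_sets.intros)
    also have "\<dots> \<le> (\<Prod>i\<le>n. 1 - c)"
      using c by (intro prod_mono) (auto simp: prob_compl)
    finally show ?thesis by simp
  qed
  moreover have "(\<lambda>n. (1 - c) ^ Suc n) \<longlonglongrightarrow> 0"
    using c(1) order_trans[OF c(2)[of 0] prob_le_1]
    by (intro LIMSEQ_Suc LIMSEQ_power_zero) simp
  ultimately have "prob ?N \<le> 0"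
    by (intro LIMSEQ_le_const) auto
  then have "prob ?N = 0"
    by (simp add: measure_le_0_iff)
  then show ?thesis
    by (subst (asm) prob_eq_0) auto
qed

section \<open>Independent clocks\<close>

locale poisson_clocks = prob_space +
  fixes tau :: "'v::{finite,linorder} \<times> nat \<Rightarrow> 'a \<Rightarrow> real"
  assumes indep: "indep_vars (\<lambda>_. borel) tau UNIV"
    and exponential: "\<And>p. distributed M lborel (tau p) (\<lambda>x. ennreal (exponential_density 1 x))"
begin

abbreviation clock_tick :: "'v \<Rightarrow> nat \<Rightarrow> 'a \<Rightarrow> real" where
  "clock_tick i k \<omega> \<equiv> tick (\<lambda>p. tau p \<omega>) i k"

lemma measurable_tau [measurable]: "tau p \<in> borel_measurable M"
  using distributed_measurable[OF exponential] by simp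

lemma measurable_clock_tick [measurable]: "clock_tick i k \<in> borel_measurable M"
  unfolding tick_def by measurable

sublocale clock: renewal_process M "\<lambda>m. tau (i, m)" for i
proof
  \<comment> \<open>The gaps of one clock are obtained as singleton blocks of the whole family, each
    evaluated at its only index.\<close>
  have "indep_vars (\<lambda>m. Pi\<^sub>M {(i, m)} (\<lambda>_. borel)) (\<lambda>m \<omega>. restrict (\<lambda>p. tau p \<omega>) {(i, m)}) UNIV"
    by (rule indep_vars_restrict[OF indep]) (auto simp: disjoint_family_on_def)
  then have "indep_vars (\<lambda>_. borel) (\<lambda>m \<omega>. restrict (\<lambda>p. tau p \<omega>) {(i, m)} (i, m)) UNIV"
    by (rule indep_vars_compose2[where Y="\<lambda>m x. x (i, m)"]) (intro measurable_component_singleton, simp)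
  then show "indep_vars (\<lambda>_. borel) (\<lambda>m. tau (i, m)) UNIV"
    by simp
qed (rule exponential)

text \<open>Each of the finitely many clocks has diverging tick times, hence finitely many ticks up
  to any \<open>t\<close>.\<close>

lemma AE_nonexplosive: "AE \<omega> in M. nonexplosive (\<lambda>p. tau p \<omega>)"
proof -
  have "AE \<omega> in M. \<forall>i. filterlim (\<lambda>n. \<Sum>m<n. tau (i, m) \<omega>) at_top sequentially"
    by (simp add: AE_all_countable clock.AE_sum_at_top)
  then show ?thesis
  proof eventually_elim
    case (elim \<omega>)
    have "finite {s. \<exists>i k. s = clock_tick i k \<omega> \<and> s \<le> t}" for t
    proof -
      have "finite {k. clock_tick i k \<omega> \<le> t}" for i
      proof -
        \<comment> \<open>Tick number \<open>k\<close> is the sum of \<open>k + 1\<close> gaps,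
          hence the index shift.\<close>
        have "filterlim (\<lambda>k. clock_tick i k \<omega>) at_top sequentially"
          using filterlim_sequentially_Suc[of "\<lambda>n. \<Sum>m<n. tau (i, m) \<omega>"] elim
          by (simp add: tick_def lessThan_Suc_atMost)
        then have "\<forall>\<^sub>F k in sequentially. clock_tick i k \<omega> > t"
          by (simp add: filterlim_at_top_dense)
        then show ?thesis
          unfolding cofinite_eq_sequentially[symmetric] eventually_cofinite by (simp add: not_less)
      qed
      then have "finite (\<Union>i. (\<lambda>k. clock_tick i k \<omega>) ` {k. clock_tick i k \<omega> \<le> t})"
        by simp
      then show ?thesis by (rule finite_subset[rotated]) auto
    qed
    then show ?case by (simp add: nonexplosive_def)
  qed
qed

text \<open>The clocks are built from disjoint blocks of independent gaps, so their void
  probabilities multiply.\<close>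

lemma prob_void:
  assumes J: "\<And>i. finite (J i)" "\<And>i. J i \<subseteq> {0..}"
  shows "prob {\<omega> \<in> space M. \<forall>i k. \<lfloor>clock_tick i k \<omega>\<rfloor> \<notin> J i} = exp (- real (\<Sum>i\<in>UNIV. card (J i)))"
proof -
  define R where "R i \<omega> = restrict (\<lambda>p. tau p \<omega>) ({i} \<times> UNIV)" for i \<omega>
  define P where "P i = Pi\<^sub>M ({i} \<times> (UNIV :: nat set)) (\<lambda>_. borel :: real measure)" for i :: 'v
  define C where "C i = {x \<in> space (P i). \<forall>k. \<lfloor>tick x i k\<rfloor> \<notin> J i}" for i
  have R: "indep_vars P R UNIV"
    unfolding P_def[abs_def] R_def[abs_def]
    by (rule indep_vars_restrict[OF indep]) (auto simp: disjoint_family_on_def)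
  have C: "C i \<in> sets (P i)" for i
  proof -
    have [measurable]: "(\<lambda>x. tick x i k) \<in> borel_measurable (P i)" for k
      unfolding tick_def P_def by (intro borel_measurable_sum measurable_component_singleton) auto
    show ?thesis unfolding C_def by measurable
  qed
  have RC: "R i -` C i \<inter> space M = {\<omega> \<in> space M. \<forall>k. \<lfloor>\<Sum>m\<le>k. tau (i, m) \<omega>\<rfloor> \<notin> J i}" for i
    by (auto simp: R_def C_def P_def space_PiM tick_def)
  have "{\<omega> \<in> space M. \<forall>i k. \<lfloor>clock_tick i k \<omega>\<rfloor> \<notin> J i} = (\<Inter>i\<in>UNIV. R i -` C i \<inter> space M)"
    unfolding RC by (auto simp: tick_def)
  also have "prob \<dots> = (\<Prod>i\<in>UNIV. prob (R i -` C i \<inter> space M))"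
    by (rule indep_varsD_finite[OF R]) (auto simp: C)
  also have "\<dots> = (\<Prod>i\<in>UNIV. exp (- real (card (J i))))"
    unfolding RC using J by (simp add: clock.prob_void)
  also have "\<dots> = exp (- real (\<Sum>i\<in>UNIV. card (J i)))"
    by (simp add: exp_sum[symmetric] sum_negf)
  finally show ?thesis .
qed

section \<open>Independent silence events and the words they spell\<close>

definition silent :: "'v \<times> nat \<Rightarrow> 'a set" where
  "silent p = {\<omega> \<in> space M. \<forall>k. \<lfloor>clock_tick (fst p) k \<omega>\<rfloor> \<noteq> int (snd p)}"

lemma sets_silent [measurable]: "silent p \<in> sets M"
  unfolding silent_def by measurable

text \<open>Slicing \<open>K\<close> by agents turns the intersection into a void event of all
  clocks, and the slice sizes add up to \<open>card K\<close>. An empty \<open>K\<close> would give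
  the whole type instead of \<open>space M\<close>.\<close>

lemma prob_silent_Inter:
  assumes "finite K" "K \<noteq> {}"
  shows "prob (\<Inter>p\<in>K. silent p) = exp (- real (card K))"
proof -
  let ?J = "\<lambda>i. int ` {j. (i, j) \<in> K}"
  have fin: "finite {j. (i, j) \<in> K}" for i
    by (rule finite_subset[OF _ finite_imageI[OF assms(1), of snd]]) force
  have "(\<Inter>p\<in>K. silent p) = {\<omega> \<in> space M. \<forall>i k. \<lfloor>clock_tick i k \<omega>\<rfloor> \<notin> ?J i}"
    using assms(2) by (fastforce simp: silent_def)
  also have "prob \<dots> = exp (- real (\<Sum>i\<in>UNIV. card (?J i)))"
    by (rule prob_void) (auto simp: fin)
  also have "(\<Sum>i\<in>UNIV. card (?J i)) = (\<Sum>i\<in>UNIV. card {j. (i, j) \<in> K})"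
    by (simp add: card_image)
  also have "\<dots> = card (SIGMA i:UNIV. {j. (i, j) \<in> K})"
    by (rule card_SigmaI[symmetric]) (auto simp: fin)
  also have "(SIGMA i:UNIV. {j. (i, j) \<in> K}) = K"
    by auto
  finally show ?thesis .
qed

lemma prob_silent: "prob (silent p) = exp (- 1)"
  using prob_silent_Inter[of "{p}"] by simp

text \<open>\<open>exp (- real (card K))\<close> is a product of \<open>card K\<close> factors
  \<open>exp (- 1)\<close>, which is the product formula defining independence.\<close>

lemma indep_silent: "indep_events silent UNIV"
  by (rule indep_eventsI) (simp_all add: prob_silent_Inter prob_silent exp_of_nat_mult[symmetric])

text \<open>During the unit intervals starting at a, a + 1, ... exactly the agents named by w tick, each
  possibly several times.\<close>
definition spells :: "'v list \<Rightarrow> nat \<Rightarrow> 'a \<Rightarrow> bool" where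
  "spells w a \<omega> \<longleftrightarrow>
     (\<forall>j\<in>{a..<a + length w}. \<forall>i. (\<exists>k. \<lfloor>clock_tick i k \<omega>\<rfloor> = int j) \<longleftrightarrow> w ! (j - a) = i)"

text \<open>Makes spelling a finite intersection of silence events and their complements: in each
  interval the named agent is not silent and all others are.\<close>

lemma spells_silent:
  assumes "\<omega> \<in> space M"
  shows "spells w a \<omega> \<longleftrightarrow>
    (\<forall>p\<in>UNIV \<times> {a..<a + length w}. \<omega> \<in> (if w ! (snd p - a) = fst p then space M - silent p else silent p))"
  using assms by (auto simp: spells_def silent_def)

text \<open>The generated sigma-algebras bring in the complements.\<close>

lemma indep_sets_silent: "indep_sets (\<lambda>p. sigma_sets (space M) {silent p}) UNIV"
  using indep_silent unfolding indep_events_def_alt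
  by (rule indep_sets_sigma) (simp add: Int_stable_def)

text \<open>One factor for each agent and interval, each at least \<open>exp (- 1)\<close>; the
  bound is independent of the starting time \<open>a\<close>.\<close>

lemma prob_spells_ge:
  "prob {\<omega> \<in> space M. spells w a \<omega>} \<ge> exp (- 1) ^ (CARD('v) * length w)"
proof (cases "w = []")
  case True
  then show ?thesis by (simp add: spells_def prob_space)
next
  case False
  let ?K = "(UNIV :: 'v set) \<times> {a..<a + length w}"
  let ?D = "\<lambda>p. if w ! (snd p - a) = fst p then space M - silent p else silent p"
  have ne: "?K \<noteq> {}" using False by auto
  \<comment> \<open>The complement of a silence event has probability \<open>1 - exp (- 1)\<close>,
    at least 1/2, so \<open>exp (- 1)\<close> bounds both kinds of factors from below.\<close>
  have "exp (- 1) \<le> (1 / 2 :: real)"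
    using exp_ge_add_one_self[of 1] by (simp add: exp_minus field_simps)
  then have ge: "prob (?D p) \<ge> exp (- 1)" for p
    using prob_compl[OF sets_silent[of p]] by (auto simp: prob_silent)
  have "exp (- 1) ^ (CARD('v) * length w) = (\<Prod>p\<in>?K. exp (- 1) :: real)"
    by (simp add: card_cartesian_product)
  also have "\<dots> \<le> (\<Prod>p\<in>?K. prob (?D p))"
    using ge by (intro prod_mono) auto
  also have "\<dots> = prob (\<Inter>p\<in>?K. ?D p)"
    by (rule indep_setsD[OF indep_sets_silent, symmetric])
       (use ne in \<open>auto intro: sigma_sets.intros\<close>)
  also have "(\<Inter>p\<in>?K. ?D p) = {\<omega> \<in> space M. spells w a \<omega>}"
  proof -
    have "?D p \<subseteq> space M" for p by (auto simp: silent_def)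
    then have "(\<Inter>p\<in>?K. ?D p) \<subseteq> space M" using ne by blast
    then show ?thesis using spells_silent by blast
  qed
  finally show ?thesis .
qed

text \<open>Starting times that are multiples of \<open>length w\<close> use disjoint blocks of unit
  intervals, and disjoint groups of independent events generate independent sigma-algebras.\<close>

lemma indep_spells: "indep_events (\<lambda>m. {\<omega> \<in> space M. spells w (m * length w) \<omega>}) UNIV"
proof -
  let ?K = "\<lambda>m. (UNIV :: 'v set) \<times> {m * length w..<m * length w + length w}"
  have "disjoint_family ?K"
  proof -
    have "m = n" if "j \<in> {m * length w..<m * length w + length w}"
      "j \<in> {n * length w..<n * length w + length w}" for j m n
    proof -
      \<comment> \<open>The number of the block containing \<open>j\<close> is its quotient by
        \<open>length w\<close>.\<close>
      have "j div length w = m" "j div length w = n"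
        using that by (auto intro!: div_nat_eqI simp: algebra_simps)
      then show ?thesis by simp
    qed
    then show ?thesis unfolding disjoint_family_on_def by blast
  qed
  moreover have "indep_sets (\<lambda>p. {silent p}) (\<Union>m\<in>UNIV. ?K m)"
    using indep_silent unfolding indep_events_def_alt by (rule indep_sets_mono_index[rotated]) simp
  ultimately have "indep_sets (\<lambda>m. sigma_sets (space M) (\<Union>p\<in>?K m. {silent p})) UNIV"
    by (intro indep_sets_collect_sigma) (auto simp: Int_stable_def)
  then show ?thesis
    unfolding indep_events_def_alt
  proof (rule indep_sets_mono_sets)
    fix m :: nat
    let ?S = "sigma_sets (space M) (\<Union>p\<in>?K m. {silent p})"
    interpret S: sigma_algebra "space M" ?S
      by (rule sigma_algebra_sigma_sets) (auto simp: silent_def)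
    have "{\<omega> \<in> space M. spells w (m * length w) \<omega>} \<in> ?S"
    proof (cases "w = []")
      case True
      then show ?thesis using S.top by (simp add: spells_def)
    next
      case False
      have "{\<omega> \<in> space M. spells w (m * length w) \<omega>} = {\<omega> \<in> space M. \<forall>p\<in>?K m.
          \<omega> \<in> (if w ! (snd p - m * length w) = fst p then space M - silent p else silent p)}"
        using spells_silent by blast
      also have "\<dots> \<in> ?S"
      proof (rule S.sets_Collect_finite_All')
        fix p assume "p \<in> ?K m"
        then have p: "silent p \<in> ?S" by (auto intro: sigma_sets.Basic)
        have "{\<omega> \<in> space M. \<omega> \<in> D} = D" if "D \<subseteq> space M" for D
          using that by blast
        then show "{\<omega> \<in> space M. \<omega> \<in> (if w ! (snd p - m * length w) = fst p then space M - silent p else silent p)} \<in> ?S"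
          using p S.sets_into_space[OF p] S.compl_sets[OF p] by auto
      qed (use False in auto)
      finally show ?thesis .
    qed
    then show "{{\<omega> \<in> space M. spells w (m * length w) \<omega>}} \<subseteq> ?S" by simp
  qed
qed

lemma AE_spells: "AE \<omega> in M. \<exists>a. spells w a \<omega>"
proof -
  have "AE \<omega> in M. \<exists>m. \<omega> \<in> {\<omega> \<in> space M. spells w (m * length w) \<omega>}"
    by (rule AE_Ex_indep_events[OF indep_spells _ prob_spells_ge]) simp
  then show ?thesis by eventually_elim blast
qed

end

theorem theorem2:
  fixes M :: "'w measure"
    and tau :: "'v::{finite,linorder} \<times> nat \<Rightarrow> 'w \<Rightarrow> real"
    and W :: "'v \<Rightarrow> 'v \<Rightarrow> real" and h :: "'v \<Rightarrow> real" and x0 :: "'v \<Rightarrow> real"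
  assumes "prob_space M"
    and "network W"
    and "x0 \<in> configs"
    and "prob_space.indep_vars M (\<lambda>_. borel) tau UNIV"
    and "\<And>p. distributed M lborel (tau p) (\<lambda>x. ennreal (exponential_density 1 x))"
  shows "AE \<omega> in M. \<exists>t0 \<ge> 0. \<forall>t \<ge> t0.
           ltd_state W h x0 (\<lambda>p. tau p \<omega>) t \<in> equilibria W h"
proof -
  interpret prob_space M by fact
  interpret poisson_clocks M tau by unfold_locales (fact assms)+
  obtain w where w: "\<And>x. x \<in> configs \<Longrightarrow> fold (ltd_update W h) w x \<in> equilibria W h"
    using universal_word[OF assms(2)] by blast
  show ?thesis
    using AE_nonexplosive AE_spells[of w]
  proof eventually_elim
    case (elim \<omega>)
    then obtain a where a: "spells w a \<omega>" by blast
    have word: "(\<exists>k. \<lfloor>clock_tick i k \<omega>\<rfloor> = int (a + j)) \<longleftrightarrow> w ! j = i" if "j < length w" for j i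
      using a[unfolded spells_def, THEN bspec, of "a + j"] that by simp
    \<comment> \<open>The time \<open>t0\<close> is the right end of the last unit interval used by
      the word.\<close>
    have "ltd_state W h x0 (\<lambda>p. tau p \<omega>) t \<in> equilibria W h" if "t \<ge> real (a + length w)" for t
      using ltd_state_equilibrium[OF assms(2,3) elim(1) w word that] .
    then show ?case by (intro exI[of _ "real (a + length w)"]) auto
  qed
qed

end
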